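(* Let $\underline\lambda,\overline\lambda\in\mathbb{R}_{\ge 0}$ with $\underline\lambda\le\overline\lambda$. For every stopping time $\tau$, every $f\in\overline{\mathbb{V}}_\tau$ and every $\omega\in\{\tau<+\infty\}$, $$\overline{\mathrm E}_{[\underline\lambda,\overline\lambda]}[f\mid\tau](\omega)=\overline{\mathrm E}_{[\underline\lambda,\overline\lambda]}[f(\omega\oplus_\tau\bullet)],\quad\text{where } f(\omega\oplus_\tau\bullet)\colon\Omega\to\overline{\mathbb{R}}\colon\varpi\mapsto f(\omega\oplus_\tau\varpi).$$
   Context: Conventions: $\mathbb{N}=\{1,2,\dots\}$; $\mathbb{R}_{\ge 0}=[0,+\infty)$; $\overline{\mathbb{R}}=\mathbb{R}\cup\{-\infty,+\infty\}$ with $+\infty-\infty=+\infty$; $\inf\emptyset=+\infty$; "increasing" means nondecreasing. Paths and variables. $\Omega$ is the set of counting paths: maps $\omega\colon\mathbb{R}_{\ge 0}\to\mathbb{Z}_{\ge 0}$ with $\omega(0)=0$ that are nondecreasing with unit jumps (every jump has size $1$) and right-continuous. A (partial) extended real variable is a map from (a subset of) $\Omega$ to $\overline{\mathbb{R}}$; "real" means it takes values in $\mathbb{R}$. For $t\in\mathbb{R}_{\ge 0}$, $N_t(\omega)=\omega(t)$. A stopping time is a map $\tau\colon\Omega\to[0,+\infty]$ such that for all $\omega_1,\omega_2\in\Omega$, if $\omega_1,\omega_2$ agree on $[0,\tau(\omega_1)]\cap\mathbb{R}_{\ge 0}$ then $\tau(\omega_1)=\tau(\omega_2)$; every $t\in\mathbb{R}_{\ge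 0}$ is identified with the constant stopping time $t$. For a real-valued stopping time $\sigma$, $N_\sigma(\omega)=\omega(\sigma(\omega))$. For a stopping time $\tau$ and $\omega\in\Omega$, $\mathcal{I}_\tau(\omega)$ is the set of $\varpi\in\Omega$ that agree with $\omega$ on $[0,\tau(\omega)]\cap\mathbb{R}_{\ge 0}$. A partial variable $f$ is $\tau$-measurable if $f(\omega_1)=f(\omega_2)$ for all $\omega_1,\omega_2\in\operatorname{dom}f$ that agree on $[0,\tau(\omega_1)]\cap\mathbb{R}_{\ge 0}$. $\{\tau<+\infty\}=\{\omega\in\Omega:\tau(\omega)<+\infty\}$, and $\overline{\mathbb{V}}_\tau$ is the set of extended real partial variables whose domain includes $\{\tau<+\infty\}$. A process is a family $\mathcal{S}_\bullet=(\mathcal{S}_t)_{t\in\mathbb{R}_{\ge 0}}$ of real variables on $\Omega$ with $\mathcal{S}_t$ $t$-measurable for all $t$; $\inf\mathcal{S}_\bullet=\inf_{t,\omega}\mathcal{S}_t(\omega)$; $\mathcal{S}_\tau(\omega)=\mathcal{S}_{\tau(\omega)}(\omega)$ for $\omega\in\{\tau<+\infty\}$; $\liminf\mathcal{S}_\bullet(\omega)=\liminf_{t\to+\infty}\mathcal{S}_t(\omega)$. Stitching. For $\omega,\varpi\in\Omega$ and a stopping time $\tau$, $\omega\oplus_\tau\varpi\in\Omega$ is the counting path with $(\omega\oplus_\tau\varpi)(t)=\omega(t)$ if $t<\tau(\omega)$ and $(\omega\oplus_\tau\varpi)(t)=\omega(\tau(\omega))+\varpi(t-\tau(\omega))$ if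 $t\ge\tau(\omega)$. Capital processes. A one-sided elementary trading strategy $G$ consists of finitely many stopping times $\tau_1\le\tau_2\le\cdots\le\tau_{n+1}$ ($n\in\mathbb{N}$) and stakes $\overline h_1,\underline h_1,\dots,\overline h_n,\underline h_n$, where $\overline h_k,\underline h_k$ are $\tau_k$-measurable bounded nonnegative real (possibly partial) variables whose domains include $\{\tau_k<+\infty\}$. With initial capital $c\in\mathbb{R}$ its capital process is $$\mathcal{K}^{G,c}_t=c+\sum_{k=1}^n\Big(\overline h_k\big(N_{\tau_{k+1}\wedge t}-N_{\tau_k\wedge t}-\overline\lambda(\tau_{k+1}\wedge t-\tau_k\wedge t)\big)+\underline h_k\big(\underline\lambda(\tau_{k+1}\wedge t-\tau_k\wedge t)-N_{\tau_{k+1}\wedge t}+N_{\tau_k\wedge t}\big)\Big),$$ where terms with $\tau_k(\omega)\wedge t=\tau_{k+1}(\omega)\wedge t$ count as zero. $\mathfrak{K}_{[\underline\lambda,\overline\lambda]}$ is the set of all such processes $\mathcal{K}^{G,c}_\bullet$. Upper expectation. For a stopping time $\tau$, $f\in\overline{\mathbb{V}}_\tau$ and $\omega\in\{\tau<+\infty\}$, $$\overline{\mathrm E}_{[\underline\lambda,\overline\lambda]}[f\mid\tau](\omega)=\inf\{\mathcal{K}_\tau(\omega):\mathcal{K}_\bullet\in\mathfrak{K}_{[\underline\lambda,\overline\lambda]},\ \inf\mathcal{K}_\bullet>-\infty,\ \liminf\mathcal{K}_\bullet(\varpi)\ge f(\varpi)\ \forall\varpi\in\mathcal{I}_\tau(\omega)\}.$$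 For the constant stopping time $0$, $\overline{\mathrm E}_{[\underline\lambda,\overline\lambda]}[f\mid 0]$ is constant on $\Omega$ (all paths start in $0$), and this constant is written $\overline{\mathrm E}_{[\underline\lambda,\overline\lambda]}[f]$. *)

theory Defs
  imports "HOL-Analysis.Analysis"
begin

type_synonym cpath = "real \<Rightarrow> nat"

text \<open>Time is \<open>[0, \<infinity>)\<close>. The value \<open>0\<close> at negative times is a normalisation: it makes a
  path, as a function on all reals, determined by its restriction to nonnegative times.
  A jump at \<open>t > 0\<close> is a difference between \<open>\<omega> t\<close> and the left limit \<open>l\<close>,
  which always exists because \<open>\<omega>\<close> is nondecreasing and takes natural values.\<close>

definition counting_paths :: "cpath set" ("\<Omega>") where
  "\<Omega> = {\<omega>. (\<forall>t<0. \<omega> t = 0) \<and> \<omega> 0 = 0 \<and> mono_on {0..} \<omega> \<and>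
        (\<forall>t\<ge>0. continuous (at_right t) \<omega>) \<and>
        (\<forall>t>0. \<forall>l. (\<omega> \<longlongrightarrow> l) (at_left t) \<longrightarrow> \<omega> t \<noteq> l \<longrightarrow> \<omega> t = l + 1)}"

definition agree_upto :: "ereal \<Rightarrow> cpath \<Rightarrow> cpath \<Rightarrow> bool" where
  "agree_upto s \<omega>1 \<omega>2 \<longleftrightarrow> (\<forall>t\<ge>0. ereal t \<le> s \<longrightarrow> \<omega>1 t = \<omega>2 t)"

definition is_stopping_time :: "(cpath \<Rightarrow> ereal) \<Rightarrow> bool" where
  "is_stopping_time \<tau> \<longleftrightarrow> (\<forall>\<omega>\<in>\<Omega>. 0 \<le> \<tau> \<omega>) \<and>
     (\<forall>\<omega>1\<in>\<Omega>. \<forall>\<omega>2\<in>\<Omega>. agree_upto (\<tau> \<omega>1) \<omega>1 \<omega>2 \<longrightarrow> \<tau> \<omega>1 = \<tau> \<omega>2)"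

definition finite_event :: "(cpath \<Rightarrow> ereal) \<Rightarrow> cpath set" where
  "finite_event \<tau> = {\<omega>\<in>\<Omega>. \<tau> \<omega> < \<infinity>}"

definition same_past :: "(cpath \<Rightarrow> ereal) \<Rightarrow> cpath \<Rightarrow> cpath set" where
  "same_past \<tau> \<omega> = {\<eta>\<in>\<Omega>. agree_upto (\<tau> \<omega>) \<omega> \<eta>}"

text \<open>Partial variables are maps whose domain is a subset of \<open>\<Omega>\<close>.\<close>

definition tau_measurable :: "(cpath \<Rightarrow> ereal) \<Rightarrow> (cpath \<rightharpoonup> 'a) \<Rightarrow> bool" where
  "tau_measurable \<tau> f \<longleftrightarrow>
     (\<forall>\<omega>1\<in>dom f. \<forall>\<omega>2\<in>dom f. agree_upto (\<tau> \<omega>1) \<omega>1 \<omega>2 \<longrightarrow> f \<omega>1 = f \<omega>2)"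

definition partial_vars :: "(cpath \<Rightarrow> ereal) \<Rightarrow> (cpath \<rightharpoonup> 'a) set" where
  "partial_vars \<tau> = {f. dom f \<subseteq> \<Omega> \<and> finite_event \<tau> \<subseteq> dom f}"

definition stitch :: "(cpath \<Rightarrow> ereal) \<Rightarrow> cpath \<Rightarrow> cpath \<Rightarrow> cpath" where
  "stitch \<tau> \<omega> \<eta> = (\<lambda>t. if ereal t < \<tau> \<omega> then \<omega> t
      else \<omega> (real_of_ereal (\<tau> \<omega>)) + \<eta> (t - real_of_ereal (\<tau> \<omega>)))"

lemma stitch_in_counting_paths:
  assumes w: "\<omega> \<in> \<Omega>" and e: "\<eta> \<in> \<Omega>" and t0: "\<tau> \<omega> = ereal s" and s0: "0 \<le> s"
  shows "stitch \<tau> \<omega> \<eta> \<in> \<Omega>"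
proof -
  let ?w = "\<lambda>t. if t < s then \<omega> t else \<omega> s + \<eta> (t - s)"
  have eq: "stitch \<tau> \<omega> \<eta> = ?w" by (intro ext) (simp add: stitch_def t0)
  have rc: "continuous (at_right t) \<omega>" "continuous (at_right t) \<eta>" if "t \<ge> 0" for t
    using w e that unfolding counting_paths_def by auto
  have mono: "\<omega> x \<le> \<omega> y" "\<eta> x \<le> \<eta> y" if "0 \<le> x" "x \<le> y" for x y
    using w e that unfolding counting_paths_def mono_on_def by auto
  have z: "\<omega> 0 = 0" "\<eta> 0 = 0" "\<And>t. t < 0 \<Longrightarrow> \<omega> t = 0" using w e unfolding counting_paths_def by auto
  have jw: "\<omega> t = l \<or> \<omega> t = l + 1" if "(\<omega> \<longlongrightarrow> l) (at_left t)" "t > 0" for t l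
    using w that unfolding counting_paths_def by blast
  have je: "\<eta> t = l \<or> \<eta> t = l + 1" if "(\<eta> \<longlongrightarrow> l) (at_left t)" "t > 0" for t l
    using e that unfolding counting_paths_def by blast
  have m: "mono_on {0..} ?w"
  proof (rule mono_onI)
    fix x y :: real assume "x \<in> {0..}" "y \<in> {0..}" "x \<le> y"
    then show "?w x \<le> ?w y"
      using mono(1)[of x s] mono(1)[of x y] mono(2)[of "x-s" "y-s"] by (auto simp: trans_le_add1)
  qed
  have c: "continuous (at_right t) ?w" if "t \<ge> 0" for t
  proof (cases "t < s")
    case True
    have "eventually (\<lambda>x. ?w x = \<omega> x) (at_right t)"
      using True eventually_at_right_real[OF True] by (auto elim: eventually_mono)
    then show ?thesis using rc(1)[OF that] True
      unfolding continuous_within by (auto simp: tendsto_cong)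
  next
    case False
    have "eventually (\<lambda>x. \<eta> x = \<eta> (t-s)) (at_right (t-s))"
      using rc(2)[of "t-s"] False unfolding continuous_within by (auto simp: tendsto_discrete)
    then have "eventually (\<lambda>x. \<eta> (x - s) = \<eta> (t-s)) (at_right t)"
      using eventually_at_right_to_0[of _ t] eventually_at_right_to_0[of _ "t-s"] by (simp add: algebra_simps)
    moreover have "eventually (\<lambda>x. x > t) (at_right t)" by (simp add: eventually_at_filter)
    ultimately have "eventually (\<lambda>x. ?w x = ?w t) (at_right t)"
      by eventually_elim (use False in auto)
    then show ?thesis unfolding continuous_within by (simp add: tendsto_discrete)
  qed
  have j: "?w t = l \<or> ?w t = l + 1" if l: "(?w \<longlongrightarrow> l) (at_left t)" "t > 0" for t l
  proof (cases "t \<le> s")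
    case True
    have "eventually (\<lambda>x. x < t) (at_left t)" by (simp add: eventually_at_filter)
    then have "eventually (\<lambda>x. ?w x = \<omega> x) (at_left t)"
      by eventually_elim (use True in auto)
    then have "(\<omega> \<longlongrightarrow> l) (at_left t)" using l(1) by (auto simp: tendsto_cong)
    with jw[of l t] l(2) z True show ?thesis by (cases "t = s") auto
  next
    case False
    have "eventually (\<lambda>x. ?w x = l) (at_left t)" using l(1) by (simp add: tendsto_discrete)
    moreover have "eventually (\<lambda>x. x > s) (at_left t)"
      using False eventually_at_left_real[of s t] by (auto elim: eventually_mono)
    ultimately have ev: "eventually (\<lambda>x. \<omega> s + \<eta> (x - s) = l) (at_left t)"
      by eventually_elim auto
    then have "\<exists>x. \<omega> s + \<eta> (x - s) = l" using eventually_happens' trivial_limit_at_left_real by blast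
    then have ge: "\<omega> s \<le> l" by auto
    obtain b where b: "b < t" "\<And>y. b < y \<Longrightarrow> y < t \<Longrightarrow> \<omega> s + \<eta> (y - s) = l"
      using ev unfolding eventually_at_left_field by blast
    have "\<eta> y = l - \<omega> s" if "b - s < y" "y < t - s" for y
      using b(2)[of "y + s"] that by simp
    then have "eventually (\<lambda>x. \<eta> x = l - \<omega> s) (at_left (t - s))"
      unfolding eventually_at_left_field using b(1) by (intro exI[of _ "b - s"]) auto
    then have "(\<eta> \<longlongrightarrow> l - \<omega> s) (at_left (t - s))" by (simp add: tendsto_discrete)
    then show ?thesis using je[of "l - \<omega> s" "t - s"] False ge by auto
  qed
  show ?thesis unfolding eq counting_paths_def mem_Collect_eq
  proof (intro conjI allI impI)
    fix t l assume "0 < t" "(?w \<longlongrightarrow> l) (at_left t)" "?w t \<noteq> l"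
    then show "?w t = l + 1" using j by blast
  next
    fix t :: real assume "t < 0"
    then show "?w t = 0" using z s0 by simp
  next
    show "?w 0 = 0" using z s0 by (cases "s = 0") auto
  qed (fact m c)+
qed

definition admissible_stake :: "(cpath \<Rightarrow> ereal) \<Rightarrow> (cpath \<rightharpoonup> real) \<Rightarrow> bool" where
  "admissible_stake \<tau> h \<longleftrightarrow> h \<in> partial_vars \<tau> \<and> tau_measurable \<tau> h \<and>
     bounded (ran h) \<and> (\<forall>x\<in>ran h. 0 \<le> x)"

text \<open>Stopping times are indexed by \<open>{1..n+1}\<close>, stakes by \<open>{1..n}\<close>; \<open>hu k\<close> and \<open>hl k\<close> are
  the stakes on the upper and on the lower rate.\<close>

definition elementary_strategy ::
  "nat \<Rightarrow> (nat \<Rightarrow> cpath \<Rightarrow> ereal) \<Rightarrow> (nat \<Rightarrow> cpath \<rightharpoonup> real) \<Rightarrow> (nat \<Rightarrow> cpath \<rightharpoonup> real) \<Rightarrow> bool" where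
  "elementary_strategy n \<tau> hu hl \<longleftrightarrow> 1 \<le> n \<and>
     (\<forall>k\<in>{1..n+1}. is_stopping_time (\<tau> k)) \<and>
     (\<forall>k\<in>{1..n}. \<forall>\<omega>\<in>\<Omega>. \<tau> k \<omega> \<le> \<tau> (k+1) \<omega>) \<and>
     (\<forall>k\<in>{1..n}. admissible_stake (\<tau> k) (hu k) \<and> admissible_stake (\<tau> k) (hl k))"

definition stop_at :: "(cpath \<Rightarrow> ereal) \<Rightarrow> real \<Rightarrow> cpath \<Rightarrow> real" where
  "stop_at \<tau> t \<omega> = real_of_ereal (min (\<tau> \<omega>) (ereal t))"

definition count_at :: "(cpath \<Rightarrow> real) \<Rightarrow> cpath \<Rightarrow> real" where
  "count_at \<sigma> \<omega> = real (\<omega> (\<sigma> \<omega>))"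

definition capital ::
  "real \<Rightarrow> real \<Rightarrow> nat \<Rightarrow> (nat \<Rightarrow> cpath \<Rightarrow> ereal) \<Rightarrow> (nat \<Rightarrow> cpath \<rightharpoonup> real) \<Rightarrow> (nat \<Rightarrow> cpath \<rightharpoonup> real)
    \<Rightarrow> real \<Rightarrow> real \<Rightarrow> cpath \<Rightarrow> real" where
  "capital lo hi n \<tau> hu hl c t \<omega> = c + (\<Sum>k=1..n.
     let a = stop_at (\<tau> k) t; b = stop_at (\<tau> (k+1)) t in
     if a \<omega> = b \<omega> then 0 else
       the (hu k \<omega>) * (count_at b \<omega> - count_at a \<omega> - hi * (b \<omega> - a \<omega>)) +
       the (hl k \<omega>) * (lo * (b \<omega> - a \<omega>) - count_at b \<omega> + count_at a \<omega>))"

definition capital_processes :: "real \<Rightarrow> real \<Rightarrow> (real \<Rightarrow> cpath \<Rightarrow> real) set" where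
  "capital_processes lo hi =
     {capital lo hi n \<tau> hu hl c | n \<tau> hu hl c. elementary_strategy n \<tau> hu hl}"

definition upper_expectation_given ::
  "real \<Rightarrow> real \<Rightarrow> (cpath \<rightharpoonup> ereal) \<Rightarrow> (cpath \<Rightarrow> ereal) \<Rightarrow> cpath \<Rightarrow> ereal" where
  "upper_expectation_given lo hi f \<tau> \<omega> =
     Inf {ereal (K (real_of_ereal (\<tau> \<omega>)) \<omega>) | K.
       K \<in> capital_processes lo hi \<and>
       (INF (t, \<eta>) \<in> {0..} \<times> \<Omega>. ereal (K t \<eta>)) > -\<infinity> \<and>
       (\<forall>\<eta>\<in>same_past \<tau> \<omega>. Liminf at_top (\<lambda>t. ereal (K t \<eta>)) \<ge> the (f \<eta>))}"

definition upper_expectation :: "real \<Rightarrow> real \<Rightarrow> (cpath \<rightharpoonup> ereal) \<Rightarrow> ereal" where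
  "upper_expectation lo hi f = (THE x. \<forall>\<omega>\<in>\<Omega>. upper_expectation_given lo hi f (\<lambda>_. 0) \<omega> = x)"

text \<open>The description above is proper: the upper expectation given time \<open>0\<close> is constant.\<close>

lemma zero_path_in_counting_paths: "(\<lambda>_. 0) \<in> \<Omega>"
  unfolding counting_paths_def by (auto simp: mono_on_def tendsto_const_iff)

lemma capital_at_0:
  assumes "elementary_strategy n \<tau> hu hl" "\<omega> \<in> \<Omega>"
  shows "capital lo hi n \<tau> hu hl c 0 \<omega> = c"
proof -
  have "stop_at (\<tau> k) 0 \<omega> = 0" if "k \<in> {1..n+1}" for k
  proof -
    have "0 \<le> \<tau> k \<omega>"
      using assms that by (auto simp: elementary_strategy_def is_stopping_time_def)
    then show ?thesis by (simp add: stop_at_def min_def zero_ereal_def[symmetric])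
  qed
  then show ?thesis
    unfolding capital_def by (simp add: Let_def)
qed

lemma upper_expectation_given_0_const:
  assumes "\<omega>1 \<in> \<Omega>" "\<omega>2 \<in> \<Omega>"
  shows "upper_expectation_given lo hi f (\<lambda>_. 0) \<omega>1 = upper_expectation_given lo hi f (\<lambda>_. 0) \<omega>2"
proof -
  have past: "same_past (\<lambda>_. 0) \<omega> = \<Omega>" if "\<omega> \<in> \<Omega>" for \<omega>
  proof -
    have "agree_upto 0 \<omega> \<eta>" if "\<eta> \<in> \<Omega>" for \<eta>
      unfolding agree_upto_def
    proof (intro allI impI)
      fix t :: real
      assume "0 \<le> t" "ereal t \<le> 0"
      then have "t = 0" by (simp add: zero_ereal_def)
      then show "\<omega> t = \<eta> t"
        using \<open>\<omega> \<in> \<Omega>\<close> \<open>\<eta> \<in> \<Omega>\<close> unfolding counting_paths_def by auto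
    qed
    then show ?thesis by (auto simp: same_past_def)
  qed
  have eq: "K 0 \<omega>1 = K 0 \<omega>2" if "K \<in> capital_processes lo hi" for K
    using that assms capital_at_0 unfolding capital_processes_def by fastforce
  show ?thesis
    unfolding upper_expectation_given_def past[OF assms(1)] past[OF assms(2)]
    by (rule arg_cong[where f = Inf], rule Collect_cong) (metis eq real_of_ereal_0)
qed

lemma upper_expectation_eq:
  assumes "\<omega> \<in> \<Omega>"
  shows "upper_expectation lo hi f = upper_expectation_given lo hi f (\<lambda>_. 0) \<omega>"
  unfolding upper_expectation_def
proof (rule the_equality)
  show "\<forall>\<omega>'\<in>\<Omega>. upper_expectation_given lo hi f (\<lambda>_. 0) \<omega>' =
      upper_expectation_given lo hi f (\<lambda>_. 0) \<omega>"
    using assms upper_expectation_given_0_const by blast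
qed (use assms in auto)

end

theory Submission
  imports Defs
begin

text \<open>
  Fix a path \<open>\<omega>\<close> with \<open>\<tau> \<omega> = s\<close> finite. The paths that share the past of \<open>\<omega>\<close> are exactly the
  stitched paths \<open>\<omega> \<oplus> \<eta>\<close>, and \<open>\<eta>\<close> is recovered as the increments after time \<open>s\<close>. So both
  upper expectations are infima of starting capitals over hedges of the same payoff: once for a market
  observed from time \<open>s\<close> on with past \<open>\<omega>\<close>, once for a market that starts afresh at time
  \<open>0\<close>. It remains to see that trading in the two markets is equally powerful.

  \<^item> A strategy in the old market can be restarted (\<open>restarted_capital_process\<close>): after
    trading along \<open>\<omega>\<close> up to time \<open>s\<close>, its continuation is a strategy on \<open>\<eta>\<close>
    with stopping times \<open>max (\<tau>\<^sub>k (\<omega> \<oplus> \<eta>)) s - s\<close>, with the stakes read off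
    \<open>\<omega> \<oplus> \<eta>\<close>, and with initial capital \<open>K s \<omega>\<close>. This capital does not depend on
    \<open>\<eta>\<close>, because the capital at time \<open>s\<close> is determined by the path up to \<open>s\<close>
    (\<open>capital_cong_past\<close>).
  \<^item> A strategy in the new market can be delayed (\<open>delayed_capital_process\<close>): wait until
    \<open>s\<close>, check that the path has followed \<open>\<omega>\<close>, and only then play the strategy on the
    increments; on every other path never trade, that is, let all stopping times be \<open>\<infinity>\<close>.

  In both cases the capital values of the new process all occur among those of the old one, so a lower
  bound is inherited, and the limit inferior is invariant under the time shift by \<open>s\<close>. Hence each
  hedge in one market yields a hedge in the other with the same starting capital, and the infima agree.
\<close>

section \<open>Cutting and stitching paths\<close>

text \<open>Only the number \<open>\<tau> \<omega>\<close> enters the stitching of \<open>\<omega>\<close>, so a constant time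
  suffices.\<close>

abbreviation glue :: "real \<Rightarrow> cpath \<Rightarrow> cpath \<Rightarrow> cpath" where
  "glue s \<equiv> stitch (\<lambda>_. ereal s)"

text \<open>Stitching an arbitrary counting path onto the past of \<open>\<omega>\<close> is inverted by taking
  increments; setting them to \<open>0\<close> at negative times matches the normalisation of paths.\<close>

definition future :: "real \<Rightarrow> cpath \<Rightarrow> cpath" where
  "future s \<eta> = (\<lambda>t. if t < 0 then 0 else \<eta> (s + t) - \<eta> s)"

lemma counting_path_neg: "\<omega> \<in> \<Omega> \<Longrightarrow> t < 0 \<Longrightarrow> \<omega> t = 0"
  and counting_path_0: "\<omega> \<in> \<Omega> \<Longrightarrow> \<omega> 0 = 0"
  and counting_path_mono: "\<omega> \<in> \<Omega> \<Longrightarrow> 0 \<le> x \<Longrightarrow> x \<le> y \<Longrightarrow> \<omega> x \<le> \<omega> y"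
  unfolding counting_paths_def mono_on_def by auto

lemma glue_apply: "glue s \<omega> \<eta> t = (if t < s then \<omega> t else \<omega> s + \<eta> (t - s))"
  by (simp add: stitch_def)

lemma glue_in_counting_paths:
  "\<omega> \<in> \<Omega> \<Longrightarrow> \<eta> \<in> \<Omega> \<Longrightarrow> 0 \<le> s \<Longrightarrow> glue s \<omega> \<eta> \<in> \<Omega>"
  by (rule stitch_in_counting_paths) auto

lemma future_in_counting_paths:
  assumes e: "\<eta> \<in> \<Omega>" and s: "0 \<le> s"
  shows "future s \<eta> \<in> \<Omega>"
proof -
  have rc: "continuous (at_right t) (future s \<eta>)" if t: "t \<ge> 0" for t
  proof -
    have "continuous (at_right (s + t)) \<eta>"
      using e s t unfolding counting_paths_def by auto
    then have "eventually (\<lambda>x. \<eta> x = \<eta> (s + t)) (at_right (s + t))"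
      unfolding continuous_within by (auto simp: tendsto_discrete)
    then have "eventually (\<lambda>x. \<eta> (s + x) = \<eta> (s + t)) (at_right t)"
      using eventually_at_right_to_0[of _ t] eventually_at_right_to_0[of _ "s + t"]
      by (simp add: algebra_simps)
    moreover have "eventually (\<lambda>x. x > t) (at_right t)" by (simp add: eventually_at_filter)
    ultimately have "eventually (\<lambda>x. future s \<eta> x = future s \<eta> t) (at_right t)"
      by eventually_elim (use t in \<open>auto simp: future_def\<close>)
    then show ?thesis unfolding continuous_within by (simp add: tendsto_discrete)
  qed
  have jump: "future s \<eta> t = l + 1"
    if t: "t > 0" and l: "(future s \<eta> \<longlongrightarrow> l) (at_left t)" and ne: "future s \<eta> t \<noteq> l" for t l
  proof -
    have "eventually (\<lambda>x. future s \<eta> x = l) (at_left t)" using l by (simp add: tendsto_discrete)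
    then obtain b where b: "b < t" "\<And>y. b < y \<Longrightarrow> y < t \<Longrightarrow> future s \<eta> y = l"
      unfolding eventually_at_left_field by blast
    \<comment> \<open>The increments are truncated subtractions of naturals and are \<open>0\<close> at negative times, so
        the left neighbourhood is shrunk to stay above \<open>s\<close>.\<close>
    have "\<eta> y = l + \<eta> s" if "s + max b 0 < y" "y < s + t" for y
    proof -
      have "b < y - s" "y - s < t" "s \<le> y" using that by auto
      then show ?thesis
        using b(2)[of "y - s"] counting_path_mono[OF e s, of y] by (simp add: future_def)
    qed
    then have "eventually (\<lambda>y. \<eta> y = l + \<eta> s) (at_left (s + t))"
      unfolding eventually_at_left_field using b(1) t by (intro exI[of _ "s + max b 0"]) auto
    then have "(\<eta> \<longlongrightarrow> l + \<eta> s) (at_left (s + t))" by (simp add: tendsto_discrete)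
    moreover have "s + t > 0" using s t by simp
    ultimately have "\<eta> (s + t) = l + \<eta> s \<or> \<eta> (s + t) = l + \<eta> s + 1"
      using e unfolding counting_paths_def by blast
    then show ?thesis using ne t by (auto simp: future_def)
  qed
  have "mono_on {0..} (future s \<eta>)"
    using counting_path_mono[OF e] s by (auto simp: mono_on_def future_def intro!: diff_le_mono)
  then show ?thesis
    unfolding counting_paths_def mem_Collect_eq using rc jump by (auto simp: future_def)
qed

lemma future_glue:
  assumes "\<eta> \<in> \<Omega>"
  shows "future s (glue s \<omega> \<eta>) = \<eta>"
  using counting_path_neg[OF assms] counting_path_0[OF assms]
  by (auto simp: future_def glue_apply)

lemma glue_future:
  assumes "\<omega> \<in> \<Omega>" "\<eta> \<in> \<Omega>" "0 \<le> s" "agree_upto (ereal s) \<omega> \<eta>"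
  shows "glue s \<omega> (future s \<eta>) = \<eta>"
proof
  fix t
  show "glue s \<omega> (future s \<eta>) t = \<eta> t"
    using assms counting_path_mono[OF assms(2,3), of t] counting_path_neg[of \<omega> t]
      counting_path_neg[of \<eta> t]
    by (cases "t < 0") (auto simp: glue_apply future_def agree_upto_def)
qed

section \<open>Agreement of pasts and stopping\<close>

lemma agree_upto_sym: "agree_upto r \<omega> \<eta> \<Longrightarrow> agree_upto r \<eta> \<omega>"
  by (simp add: agree_upto_def)

lemma agree_upto_trans: "agree_upto r \<omega> \<eta> \<Longrightarrow> agree_upto r \<eta> \<zeta> \<Longrightarrow> agree_upto r \<omega> \<zeta>"
  by (simp add: agree_upto_def)

lemma agree_upto_mono: "agree_upto r \<omega> \<eta> \<Longrightarrow> q \<le> r \<Longrightarrow> agree_upto q \<omega> \<eta>"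
  unfolding agree_upto_def by (meson order_trans)

lemma agree_upto_glue:
  assumes "\<eta> \<in> \<Omega>"
  shows "agree_upto (ereal s) \<omega> (glue s \<omega> \<eta>)"
  using counting_path_0[OF assms] by (auto simp: agree_upto_def glue_apply order_le_less)

lemma agree_upto_glue_glue:
  assumes "agree_upto r \<eta>1 \<eta>2"
  shows "agree_upto (ereal s + r) (glue s \<omega> \<eta>1) (glue s \<omega> \<eta>2)"
  unfolding agree_upto_def
proof (intro allI impI)
  fix t :: real
  assume t: "0 \<le> t" "ereal t \<le> ereal s + r"
  have "ereal (t - s) \<le> r" using t(2) by (cases r) auto
  then show "glue s \<omega> \<eta>1 t = glue s \<omega> \<eta>2 t"
    using assms by (auto simp: glue_apply agree_upto_def)
qed

lemma agree_upto_future_future: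
  assumes "agree_upto (ereal s + r) \<eta>1 \<eta>2" "0 \<le> s" "0 \<le> r"
  shows "agree_upto r (future s \<eta>1) (future s \<eta>2)"
  unfolding agree_upto_def
proof (intro allI impI)
  fix t :: real
  assume t: "0 \<le> t" "ereal t \<le> r"
  have "ereal (s + t) \<le> ereal s + r" using t(2) by (cases r) auto
  moreover have "ereal s \<le> ereal s + r" using assms(3) by (cases r) auto
  ultimately show "future s \<eta>1 t = future s \<eta>2 t"
    using assms(1,2) t(1) by (auto simp: future_def agree_upto_def)
qed

lemma stopping_time_nonneg: "is_stopping_time \<sigma> \<Longrightarrow> \<omega> \<in> \<Omega> \<Longrightarrow> 0 \<le> \<sigma> \<omega>"
  unfolding is_stopping_time_def by blast

lemma stopping_time_cong:
  "is_stopping_time \<sigma> \<Longrightarrow> \<omega> \<in> \<Omega> \<Longrightarrow> \<eta> \<in> \<Omega> \<Longrightarrow> agree_upto (\<sigma> \<omega>) \<omega> \<eta> \<Longrightarrow> \<sigma> \<omega> = \<sigma> \<eta>"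
  unfolding is_stopping_time_def by blast

text \<open>A fixed time \<open>r\<close> suffices to know a stopping time truncated at \<open>r\<close>: if it
  exceeds \<open>r\<close> on one path but not on the other, agreement up to its smaller value would force
  the two values to be equal.\<close>

lemma stopping_time_min_cong:
  assumes "is_stopping_time \<sigma>" "\<omega> \<in> \<Omega>" "\<eta> \<in> \<Omega>" "agree_upto r \<omega> \<eta>"
  shows "min (\<sigma> \<omega>) r = min (\<sigma> \<eta>) r"
proof -
  have "\<sigma> \<omega> = \<sigma> \<eta>" if "\<sigma> \<omega> \<le> r"
    by (rule stopping_time_cong[OF assms(1-3) agree_upto_mono[OF assms(4) that]])
  moreover have "\<sigma> \<eta> = \<sigma> \<omega>" if "\<sigma> \<eta> \<le> r"
    by (rule stopping_time_cong[OF assms(1,3,2) agree_upto_mono[OF agree_upto_sym[OF assms(4)] that]])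
  ultimately show ?thesis by (metis linear min.absorb2)
qed

section \<open>Capital as a sum of interval gains\<close>

text \<open>The gain over one period is a difference of a function of the two end points. It therefore
  vanishes on empty periods, in agreement with their counting as zero in the capital, and it is
  additive in the period, which allows cutting it at time \<open>s\<close>.\<close>

definition period_gain ::
  "real \<Rightarrow> real \<Rightarrow> real \<Rightarrow> real \<Rightarrow> real \<Rightarrow> real \<Rightarrow> cpath \<Rightarrow> real" where
  "period_gain lo hi u l a b \<omega> =
     u * (real (\<omega> b) - real (\<omega> a) - hi * (b - a)) + l * (lo * (b - a) - real (\<omega> b) + real (\<omega> a))"

lemma capital_eq_sum_period_gain:
  "capital lo hi n \<tau> hu hl c t \<omega> = c + (\<Sum>k=1..n. period_gain lo hi (the (hu k \<omega>)) (the (hl k \<omega>))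
     (stop_at (\<tau> k) t \<omega>) (stop_at (\<tau> (k+1)) t \<omega>) \<omega>)"
  unfolding capital_def
  by (intro arg_cong2[where f = "(+)"] refl sum.cong) (auto simp: Let_def period_gain_def count_at_def)

lemma period_gain_empty: "period_gain lo hi u l a a \<omega> = 0"
  by (simp add: period_gain_def)

text \<open>The clamped end points also cover periods that lie on one side of \<open>s\<close>: then one of the
  two parts is empty.\<close>

lemma period_gain_split:
  "period_gain lo hi u l a b \<omega> =
     period_gain lo hi u l (min a s) (min b s) \<omega> + period_gain lo hi u l (max a s) (max b s) \<omega>"
  by (cases "a \<le> s"; cases "b \<le> s") (auto simp: period_gain_def min_def max_def algebra_simps)

lemma period_gain_glue:
  assumes "0 \<le> a" "0 \<le> b"
  shows "period_gain lo hi u l (s + a) (s + b) (glue s \<omega> \<eta>) = period_gain lo hi u l a b \<eta>"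
  using assms by (simp add: period_gain_def glue_apply algebra_simps)

lemma stop_at_nonneg:
  assumes "0 \<le> \<sigma> \<omega>" "0 \<le> t"
  shows "0 \<le> stop_at \<sigma> t \<omega>"
  using assms by (cases "\<sigma> \<omega>") (auto simp: stop_at_def min_def)

lemma admissible_stake_cong:
  assumes "admissible_stake \<sigma> h" "\<omega> \<in> finite_event \<sigma>" "\<eta> \<in> finite_event \<sigma>"
    and "agree_upto (\<sigma> \<omega>) \<omega> \<eta>"
  shows "h \<omega> = h \<eta>"
  using assms unfolding admissible_stake_def tau_measurable_def partial_vars_def by blast

text \<open>The process is adapted. A period that has started by time \<open>t\<close> has its starting time and its
  stakes determined by the past up to \<open>t\<close>; stakes of later periods may differ between the two
  paths, but they are multiplied by the gain of an empty period.\<close>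

lemma capital_cong_past:
  assumes str: "elementary_strategy n \<tau> hu hl"
    and w: "\<omega> \<in> \<Omega>" and e: "\<eta> \<in> \<Omega>" and agr: "agree_upto (ereal t) \<omega> \<eta>" and t: "0 \<le> t"
  shows "capital lo hi n \<tau> hu hl c t \<omega> = capital lo hi n \<tau> hu hl c t \<eta>"
proof -
  have st: "is_stopping_time (\<tau> k)" if "k \<in> {1..n+1}" for k
    using str that by (auto simp: elementary_strategy_def)
  have stop: "stop_at (\<tau> k) t \<omega> = stop_at (\<tau> k) t \<eta>" if "k \<in> {1..n+1}" for k
    using stopping_time_min_cong[OF st[OF that] w e agr] by (simp add: stop_at_def)
  have val: "\<omega> (stop_at (\<tau> k) t \<omega>) = \<eta> (stop_at (\<tau> k) t \<omega>)" if k: "k \<in> {1..n+1}" for k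
  proof -
    have nn: "0 \<le> \<tau> k \<omega>" by (rule stopping_time_nonneg[OF st[OF k] w])
    then have "stop_at (\<tau> k) t \<omega> \<le> t"
      by (cases "\<tau> k \<omega>") (auto simp: stop_at_def min_def)
    then show ?thesis
      using agr stop_at_nonneg[of "\<tau> k" \<omega> t] nn t by (auto simp: agree_upto_def)
  qed
  have "period_gain lo hi (the (hu k \<omega>)) (the (hl k \<omega>))
          (stop_at (\<tau> k) t \<omega>) (stop_at (\<tau> (k+1)) t \<omega>) \<omega> =
        period_gain lo hi (the (hu k \<eta>)) (the (hl k \<eta>))
          (stop_at (\<tau> k) t \<eta>) (stop_at (\<tau> (k+1)) t \<eta>) \<eta>" if k: "k \<in> {1..n}" for k
  proof (cases "\<tau> k \<omega> \<le> ereal t")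
    case True
    have k': "k \<in> {1..n+1}" "k + 1 \<in> {1..n+1}" using k by auto
    have agr': "agree_upto (\<tau> k \<omega>) \<omega> \<eta>" using agr True by (rule agree_upto_mono)
    have "\<tau> k \<omega> = \<tau> k \<eta>" by (rule stopping_time_cong[OF st[OF k'(1)] w e agr'])
    then have fin: "\<omega> \<in> finite_event (\<tau> k)" "\<eta> \<in> finite_event (\<tau> k)"
      using le_less_trans[OF True, of \<infinity>] w e by (simp_all add: finite_event_def)
    have "admissible_stake (\<tau> k) (hu k)" "admissible_stake (\<tau> k) (hl k)"
      using str k by (auto simp: elementary_strategy_def)
    then have "hu k \<omega> = hu k \<eta>" "hl k \<omega> = hl k \<eta>"
      using admissible_stake_cong[OF _ fin agr'] by blast+
    then show ?thesis
      using stop[OF k'(1)] stop[OF k'(2)] val[OF k'(1)] val[OF k'(2)] by (simp add: period_gain_def)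
  next
    case False
    have "\<tau> k \<omega> \<le> \<tau> (k+1) \<omega>" using str k w by (auto simp: elementary_strategy_def)
    then have "stop_at (\<tau> k) t \<omega> = t" "stop_at (\<tau> (k+1)) t \<omega> = t"
      using False by (auto simp: stop_at_def min_def)
    then show ?thesis
      using stop[of k] stop[of "k+1"] k by (simp add: period_gain_empty)
  qed
  then show ?thesis unfolding capital_eq_sum_period_gain by simp
qed

section \<open>Restarting and delaying strategies\<close>

text \<open>Periods that end before \<open>s\<close> collapse to empty periods at time \<open>0\<close>, and a period that
  is under way at \<open>s\<close> is resumed at time \<open>0\<close> with its old stakes. What was earned before
  \<open>s\<close> becomes initial capital.\<close>

lemma restarted_capital_process:
  assumes K: "K \<in> capital_processes lo hi" and w: "\<omega> \<in> \<Omega>" and s: "0 \<le> s"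
  obtains K' where "K' \<in> capital_processes lo hi"
    and "\<And>t \<eta>. 0 \<le> t \<Longrightarrow> \<eta> \<in> \<Omega> \<Longrightarrow> K' t \<eta> = K (s + t) (glue s \<omega> \<eta>)"
    and "\<And>\<eta>. \<eta> \<in> \<Omega> \<Longrightarrow> K' 0 \<eta> = K s \<omega>"
proof -
  obtain n \<tau> hu hl c where Keq: "K = capital lo hi n \<tau> hu hl c"
    and str: "elementary_strategy n \<tau> hu hl"
    using K by (auto simp: capital_processes_def)
  have gl: "glue s \<omega> \<eta> \<in> \<Omega>" if "\<eta> \<in> \<Omega>" for \<eta>
    using glue_in_counting_paths w that s by blast
  define \<sigma> where "\<sigma> k \<eta> = max (\<tau> k (glue s \<omega> \<eta>)) (ereal s) - ereal s" for k \<eta>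
  define restart where "restart h k = (\<lambda>\<eta>. h k (glue s \<omega> \<eta>)) |` \<Omega>"
    for h :: "nat \<Rightarrow> cpath \<rightharpoonup> real" and k
  have st: "is_stopping_time (\<tau> k)" if "k \<in> {1..n+1}" for k
    using str that by (auto simp: elementary_strategy_def)
  have shift: "ereal s + \<sigma> k \<eta> = max (\<tau> k (glue s \<omega> \<eta>)) (ereal s)" for k \<eta>
    by (cases "\<tau> k (glue s \<omega> \<eta>)") (auto simp: \<sigma>_def max_def)
  \<comment> \<open>All that is needed to transfer measurability: knowing \<open>\<eta>\<close> up to the new stopping time means
      knowing the stitched path at least up to the old one.\<close>
  have glued: "agree_upto (\<tau> k (glue s \<omega> \<eta>1)) (glue s \<omega> \<eta>1) (glue s \<omega> \<eta>2)"
    if "agree_upto (\<sigma> k \<eta>1) \<eta>1 \<eta>2" for k \<eta>1 \<eta>2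
    using agree_upto_glue_glue[OF that, of s \<omega>] unfolding shift by (rule agree_upto_mono) simp
  have "is_stopping_time (\<sigma> k)" if k: "k \<in> {1..n+1}" for k
    unfolding is_stopping_time_def
  proof (intro conjI ballI impI)
    fix \<eta> assume "\<eta> \<in> \<Omega>"
    show "0 \<le> \<sigma> k \<eta>" by (cases "\<tau> k (glue s \<omega> \<eta>)") (auto simp: \<sigma>_def max_def)
  next
    fix \<eta>1 \<eta>2 assume "\<eta>1 \<in> \<Omega>" "\<eta>2 \<in> \<Omega>" "agree_upto (\<sigma> k \<eta>1) \<eta>1 \<eta>2"
    then have "\<tau> k (glue s \<omega> \<eta>1) = \<tau> k (glue s \<omega> \<eta>2)"
      by (intro stopping_time_cong[OF st[OF k]] gl glued)
    then show "\<sigma> k \<eta>1 = \<sigma> k \<eta>2" by (simp add: \<sigma>_def)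
  qed
  moreover have "\<sigma> k \<eta> \<le> \<sigma> (k+1) \<eta>" if "k \<in> {1..n}" "\<eta> \<in> \<Omega>" for k \<eta>
  proof -
    have "\<tau> k (glue s \<omega> \<eta>) \<le> \<tau> (k+1) (glue s \<omega> \<eta>)"
      using str that gl by (auto simp: elementary_strategy_def)
    then show ?thesis unfolding \<sigma>_def by (intro ereal_minus_mono max.mono) auto
  qed
  moreover have "admissible_stake (\<sigma> k) (restart h k)"
    if adm: "admissible_stake (\<tau> k) (h k)" for h k
  proof -
    have "restart h k \<in> partial_vars (\<sigma> k)"
      unfolding partial_vars_def
    proof (intro CollectI conjI subsetI)
      fix \<eta> assume "\<eta> \<in> finite_event (\<sigma> k)"
      then have e: "\<eta> \<in> \<Omega>" and "\<sigma> k \<eta> < \<infinity>" by (auto simp: finite_event_def)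
      then have "glue s \<omega> \<eta> \<in> finite_event (\<tau> k)"
        using gl[OF e] by (cases "\<tau> k (glue s \<omega> \<eta>)") (auto simp: finite_event_def \<sigma>_def)
      then have "glue s \<omega> \<eta> \<in> dom (h k)"
        using adm by (auto simp: admissible_stake_def partial_vars_def)
      then show "\<eta> \<in> dom (restart h k)" using e by (auto simp: restart_def)
    qed (auto simp: restart_def restrict_map_def split: if_splits)
    moreover have "tau_measurable (\<sigma> k) (restart h k)"
      using adm glued unfolding admissible_stake_def tau_measurable_def restart_def
      by (auto simp: restrict_map_def dom_def split: if_splits)
    moreover have "ran (restart h k) \<subseteq> ran (h k)"
      by (auto simp: ran_def restart_def restrict_map_def split: if_splits)
    ultimately show ?thesis
      using adm bounded_subset unfolding admissible_stake_def by blast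
  qed
  ultimately have str': "elementary_strategy n \<sigma> (restart hu) (restart hl)"
    using str unfolding elementary_strategy_def by blast
  define K' where "K' = capital lo hi n \<sigma> (restart hu) (restart hl) (K s \<omega>)"
  have main: "K' t \<eta> = K (s + t) (glue s \<omega> \<eta>)" if t: "0 \<le> t" and e: "\<eta> \<in> \<Omega>" for t \<eta>
  proof -
    let ?g = "glue s \<omega> \<eta>"
    have past: "K s \<omega> = K s ?g"
      unfolding Keq by (rule capital_cong_past[OF str w gl[OF e] agree_upto_glue[OF e] s])
    have nn: "0 \<le> \<tau> k ?g" if "k \<in> {1..n+1}" for k
      by (rule stopping_time_nonneg[OF st[OF that] gl[OF e]])
    have before: "min (stop_at (\<tau> k) (s + t) ?g) s = stop_at (\<tau> k) s ?g" if "k \<in> {1..n+1}" for k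
      using nn[OF that] t by (cases "\<tau> k ?g") (auto simp: stop_at_def min_def)
    have after: "max (stop_at (\<tau> k) (s + t) ?g) s = s + stop_at (\<sigma> k) t \<eta>"
      if "k \<in> {1..n+1}" for k
      using nn[OF that] t by (cases "\<tau> k ?g") (auto simp: stop_at_def \<sigma>_def min_def max_def)
    have nn': "0 \<le> stop_at (\<sigma> k) t \<eta>" if "k \<in> {1..n+1}" for k
      using after[OF that] by (auto simp: max_def split: if_splits)
    have "period_gain lo hi (the (hu k ?g)) (the (hl k ?g))
            (stop_at (\<tau> k) (s + t) ?g) (stop_at (\<tau> (k+1)) (s + t) ?g) ?g =
          period_gain lo hi (the (hu k ?g)) (the (hl k ?g))
            (stop_at (\<tau> k) s ?g) (stop_at (\<tau> (k+1)) s ?g) ?g +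
          period_gain lo hi (the (restart hu k \<eta>)) (the (restart hl k \<eta>))
            (stop_at (\<sigma> k) t \<eta>) (stop_at (\<sigma> (k+1)) t \<eta>) \<eta>" if "k \<in> {1..n}" for k
    proof -
      have k: "k \<in> {1..n+1}" "k + 1 \<in> {1..n+1}" using that by auto
      show ?thesis
        by (subst period_gain_split[where s = s],
            simp only: before[OF k(1)] before[OF k(2)] after[OF k(1)] after[OF k(2)]
              period_gain_glue[OF nn'[OF k(1)] nn'[OF k(2)]])
          (simp add: restart_def e)
    qed
    then have "K (s + t) ?g = K s ?g + (\<Sum>k=1..n.
        period_gain lo hi (the (restart hu k \<eta>)) (the (restart hl k \<eta>))
            (stop_at (\<sigma> k) t \<eta>) (stop_at (\<sigma> (k+1)) t \<eta>) \<eta>)"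
      unfolding Keq capital_eq_sum_period_gain by (simp add: sum.distrib)
    then show ?thesis unfolding K'_def capital_eq_sum_period_gain past by simp
  qed
  show ?thesis
  proof (rule that[of K'])
    show "K' \<in> capital_processes lo hi"
      using str' unfolding K'_def capital_processes_def by blast
    show "K' 0 \<eta> = K s \<omega>" if "\<eta> \<in> \<Omega>" for \<eta>
      unfolding K'_def by (rule capital_at_0[OF str' that])
  qed (fact main)
qed

text \<open>Whether a path follows \<open>\<omega>\<close> is known at time \<open>s\<close>, and none of the delayed
  periods starts earlier; this is why the delayed times are stopping times. Waiting and refusing to trade both
  leave the capital at its initial value \<open>K 0 \<eta>\<close>, so no new small values arise.\<close>

lemma delayed_capital_process:
  assumes K: "K \<in> capital_processes lo hi" and w: "\<omega> \<in> \<Omega>" and s: "0 \<le> s"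
  obtains K' where "K' \<in> capital_processes lo hi"
    and "\<And>t \<eta>. 0 \<le> t \<Longrightarrow> \<eta> \<in> \<Omega> \<Longrightarrow> K' (s + t) (glue s \<omega> \<eta>) = K t \<eta>"
    and "\<And>t \<eta>. \<eta> \<in> \<Omega> \<Longrightarrow> t \<le> s \<or> \<not> agree_upto (ereal s) \<omega> \<eta> \<Longrightarrow> K' t \<eta> = K 0 \<eta>"
proof -
  obtain n \<tau> hu hl c where Keq: "K = capital lo hi n \<tau> hu hl c"
    and str: "elementary_strategy n \<tau> hu hl"
    using K by (auto simp: capital_processes_def)
  have fu: "future s \<eta> \<in> \<Omega>" if "\<eta> \<in> \<Omega>" for \<eta>
    using future_in_counting_paths that s by blast
  define \<sigma> where "\<sigma> k \<eta> = (if agree_upto (ereal s) \<omega> \<eta> then ereal s + \<tau> k (future s \<eta>) else \<infinity>)"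
    for k \<eta>
  define delay where
    "delay h k = (\<lambda>\<eta>. h k (future s \<eta>)) |` {\<eta>\<in>\<Omega>. agree_upto (ereal s) \<omega> \<eta>}"
    for h :: "nat \<Rightarrow> cpath \<rightharpoonup> real" and k
  have st: "is_stopping_time (\<tau> k)" if "k \<in> {1..n+1}" for k
    using str that by (auto simp: elementary_strategy_def)
  have nn: "0 \<le> \<tau> k \<eta>" if "k \<in> {1..n+1}" "\<eta> \<in> \<Omega>" for k \<eta>
    by (rule stopping_time_nonneg[OF st[OF that(1)] that(2)])
  have ge: "ereal s \<le> \<sigma> k \<eta>" if "k \<in> {1..n+1}" "\<eta> \<in> \<Omega>" for k \<eta>
    using nn[OF that(1) fu[OF that(2)]] by (cases "\<tau> k (future s \<eta>)") (auto simp: \<sigma>_def)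
  \<comment> \<open>The delayed times are at least \<open>s\<close>, so a path agreeing with \<open>\<eta>1\<close> that long also follows
      \<open>\<omega>\<close>.\<close>
  have split: "agree_upto (ereal s) \<omega> \<eta>2 \<and> agree_upto (\<tau> k (future s \<eta>1)) (future s \<eta>1) (future s \<eta>2)"
    if "k \<in> {1..n+1}" "\<eta>1 \<in> \<Omega>" "agree_upto (\<sigma> k \<eta>1) \<eta>1 \<eta>2" "agree_upto (ereal s) \<omega> \<eta>1"
    for k \<eta>1 \<eta>2
    using agree_upto_trans[OF that(4) agree_upto_mono[OF that(3) ge[OF that(1,2)]]]
      agree_upto_future_future[OF _ s nn[OF that(1) fu[OF that(2)]], of \<eta>1 \<eta>2] that(3,4)
    by (simp add: \<sigma>_def)
  have "is_stopping_time (\<sigma> k)" if k: "k \<in> {1..n+1}" for k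
    unfolding is_stopping_time_def
  proof (intro conjI ballI impI)
    fix \<eta> assume "\<eta> \<in> \<Omega>"
    then have "ereal s \<le> \<sigma> k \<eta>" by (rule ge[OF k])
    then show "0 \<le> \<sigma> k \<eta>" using s by (meson ereal_less_eq(5) order_trans)
  next
    fix \<eta>1 \<eta>2 assume e: "\<eta>1 \<in> \<Omega>" "\<eta>2 \<in> \<Omega>" and agr: "agree_upto (\<sigma> k \<eta>1) \<eta>1 \<eta>2"
    show "\<sigma> k \<eta>1 = \<sigma> k \<eta>2"
    proof (cases "agree_upto (ereal s) \<omega> \<eta>1")
      case True
      note sp = split[OF k e(1) agr True]
      then have "\<tau> k (future s \<eta>1) = \<tau> k (future s \<eta>2)"
        by (intro stopping_time_cong[OF st[OF k]] fu e) simp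
      then show ?thesis using True sp by (simp add: \<sigma>_def)
    next
      case False
      \<comment> \<open>Here the delayed time is \<open>\<infinity>\<close>, and agreement up to \<open>\<infinity>\<close> is agreement at all
          nonnegative times.\<close>
      then have "\<not> agree_upto (ereal s) \<omega> \<eta>2"
        using agr agree_upto_trans[OF _ agree_upto_sym] agree_upto_mono[of \<infinity> \<eta>1 \<eta>2 "ereal s"]
        by (auto simp: \<sigma>_def)
      then show ?thesis using False by (simp add: \<sigma>_def)
    qed
  qed
  moreover have mono: "\<sigma> k \<eta> \<le> \<sigma> (k+1) \<eta>" if "k \<in> {1..n}" "\<eta> \<in> \<Omega>" for k \<eta>
    using str that fu by (auto simp: elementary_strategy_def \<sigma>_def intro!: add_left_mono)
  moreover have "admissible_stake (\<sigma> k) (delay h k)"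
    if k: "k \<in> {1..n}" and adm: "admissible_stake (\<tau> k) (h k)" for h k
  proof -
    have "delay h k \<in> partial_vars (\<sigma> k)"
      unfolding partial_vars_def
    proof (intro CollectI conjI subsetI)
      fix \<eta> assume "\<eta> \<in> finite_event (\<sigma> k)"
      then have e: "\<eta> \<in> \<Omega>" and fin: "\<sigma> k \<eta> < \<infinity>" by (auto simp: finite_event_def)
      then have agr: "agree_upto (ereal s) \<omega> \<eta>" by (auto simp: \<sigma>_def split: if_splits)
      have "future s \<eta> \<in> finite_event (\<tau> k)"
        using fin agr fu[OF e] by (auto simp: finite_event_def \<sigma>_def)
      then have "future s \<eta> \<in> dom (h k)"
        using adm by (auto simp: admissible_stake_def partial_vars_def)
      then show "\<eta> \<in> dom (delay h k)" using e agr by (auto simp: delay_def)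
    qed (auto simp: delay_def restrict_map_def split: if_splits)
    moreover have "tau_measurable (\<sigma> k) (delay h k)"
      unfolding tau_measurable_def
    proof (intro ballI impI)
      fix \<eta>1 \<eta>2
      assume d: "\<eta>1 \<in> dom (delay h k)" "\<eta>2 \<in> dom (delay h k)" and agr: "agree_upto (\<sigma> k \<eta>1) \<eta>1 \<eta>2"
      then have "\<eta>1 \<in> \<Omega>" "agree_upto (ereal s) \<omega> \<eta>1"
        by (auto simp: delay_def)
      then have "agree_upto (\<tau> k (future s \<eta>1)) (future s \<eta>1) (future s \<eta>2)"
        using split[of k \<eta>1 \<eta>2] agr k by auto
      moreover have "future s \<eta>1 \<in> dom (h k)" "future s \<eta>2 \<in> dom (h k)"
        using d by (auto simp: delay_def)
      ultimately have "h k (future s \<eta>1) = h k (future s \<eta>2)"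
        using adm unfolding admissible_stake_def tau_measurable_def by blast
      then show "delay h k \<eta>1 = delay h k \<eta>2"
        using d by (auto simp: delay_def)
    qed
    moreover have "ran (delay h k) \<subseteq> ran (h k)"
      by (auto simp: ran_def delay_def restrict_map_def split: if_splits)
    ultimately show ?thesis
      using adm bounded_subset unfolding admissible_stake_def by blast
  qed
  ultimately have str': "elementary_strategy n \<sigma> (delay hu) (delay hl)"
    using str unfolding elementary_strategy_def by blast
  define K' where "K' = capital lo hi n \<sigma> (delay hu) (delay hl) c"
  have main: "K' (s + t) (glue s \<omega> \<eta>) = K t \<eta>" if t: "0 \<le> t" and e: "\<eta> \<in> \<Omega>" for t \<eta>
  proof -
    let ?g = "glue s \<omega> \<eta>"
    have agr: "agree_upto (ereal s) \<omega> ?g" by (rule agree_upto_glue[OF e])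
    have g: "?g \<in> \<Omega>" using glue_in_counting_paths w e s by blast
    have stop: "stop_at (\<sigma> k) (s + t) ?g = s + stop_at (\<tau> k) t \<eta>" if "k \<in> {1..n+1}" for k
      using nn[OF that e] agr future_glue[OF e, of s] t
      by (cases "\<tau> k \<eta>") (auto simp: stop_at_def \<sigma>_def min_def)
    have "period_gain lo hi (the (delay hu k ?g)) (the (delay hl k ?g))
            (stop_at (\<sigma> k) (s + t) ?g) (stop_at (\<sigma> (k+1)) (s + t) ?g) ?g =
          period_gain lo hi (the (hu k \<eta>)) (the (hl k \<eta>))
            (stop_at (\<tau> k) t \<eta>) (stop_at (\<tau> (k+1)) t \<eta>) \<eta>" if "k \<in> {1..n}" for k
    proof -
      have k: "k \<in> {1..n+1}" "k + 1 \<in> {1..n+1}" using that by auto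
      have "0 \<le> stop_at (\<tau> k) t \<eta>" "0 \<le> stop_at (\<tau> (k+1)) t \<eta>"
        using stop_at_nonneg nn e k t by blast+
      from period_gain_glue[OF this] show ?thesis
        unfolding stop[OF k(1)] stop[OF k(2)]
        by (simp add: delay_def agr g future_glue[OF e])
    qed
    then show ?thesis unfolding Keq K'_def capital_eq_sum_period_gain by simp
  qed
  have idle: "K' t \<eta> = K 0 \<eta>" if e: "\<eta> \<in> \<Omega>" and "t \<le> s \<or> \<not> agree_upto (ereal s) \<omega> \<eta>" for t \<eta>
  proof -
    have "stop_at (\<sigma> k) t \<eta> = t" if "k \<in> {1..n+1}" for k
    proof -
      have "ereal t \<le> \<sigma> k \<eta>"
        using \<open>t \<le> s \<or> _\<close> ge[OF that e] by (auto simp: \<sigma>_def intro: order_trans[of _ "ereal s"])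
      then show ?thesis by (simp add: stop_at_def min_def)
    qed
    then have "K' t \<eta> = c" unfolding K'_def capital_eq_sum_period_gain by (simp add: period_gain_empty)
    also have "c = K 0 \<eta>" unfolding Keq using capital_at_0[OF str e] by simp
    finally show ?thesis .
  qed
  show ?thesis
  proof (rule that[of K'])
    show "K' \<in> capital_processes lo hi"
      using str' unfolding K'_def capital_processes_def by blast
  qed (fact main idle)+
qed

section \<open>Hedges\<close>

lemma Liminf_at_top_shift:
  fixes g :: "real \<Rightarrow> ereal"
  shows "Liminf at_top (\<lambda>t. g (s + t)) = Liminf at_top g"
proof -
  have "filtermap ((+) s) at_top = (at_top :: real filter)"
  proof (rule filtermap_fun_inverse[where g = "\<lambda>t. - s + t"])
    show "filterlim (\<lambda>t. - s + t) at_top at_top" "filterlim ((+) s) at_top at_top"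
      by (rule filterlim_tendsto_add_at_top[OF tendsto_const filterlim_ident])+
  qed simp
  then show ?thesis
    using Liminf_filtermap_eq[of "(+) s" at_top g] by (simp add: inj_def)
qed

text \<open>The processes over which the upper expectation is minimised: the payoff \<open>g\<close> has to be
  covered on the paths in \<open>P\<close> only, whereas the lower bound is required on all of \<open>\<Omega>\<close>.
  Separating the two lets conditional and unconditional upper expectations be compared through
  \<open>P\<close>.\<close>

definition hedges :: "real \<Rightarrow> real \<Rightarrow> cpath set \<Rightarrow> (cpath \<Rightarrow> ereal) \<Rightarrow> (real \<Rightarrow> cpath \<Rightarrow> real) set" where
  "hedges lo hi P g = {K \<in> capital_processes lo hi.
     (INF (t, \<eta>) \<in> {0..} \<times> \<Omega>. ereal (K t \<eta>)) > -\<infinity> \<and>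
     (\<forall>\<eta>\<in>P. g \<eta> \<le> Liminf at_top (\<lambda>t. ereal (K t \<eta>)))}"

lemma upper_expectation_given_eq_INF_hedges:
  "upper_expectation_given lo hi f \<tau> \<omega> =
     (INF K \<in> hedges lo hi (same_past \<tau> \<omega>) (\<lambda>\<eta>. the (f \<eta>)). ereal (K (real_of_ereal (\<tau> \<omega>)) \<omega>))"
  unfolding upper_expectation_given_def hedges_def by (rule arg_cong[where f = Inf]) auto

lemma hedges_cong:
  "(\<And>\<eta>. \<eta> \<in> P \<Longrightarrow> g \<eta> = g' \<eta>) \<Longrightarrow> hedges lo hi P g = hedges lo hi P g'"
  unfolding hedges_def by auto

lemma restarted_hedge:
  assumes K: "K \<in> hedges lo hi (glue s \<omega> ` \<Omega>) g" and w: "\<omega> \<in> \<Omega>" and s: "0 \<le> s"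
  obtains K' where "K' \<in> hedges lo hi \<Omega> (\<lambda>\<eta>. g (glue s \<omega> \<eta>))" "K' 0 \<omega> = K s \<omega>"
proof -
  obtain K' where K': "K' \<in> capital_processes lo hi"
    "\<And>t \<eta>. 0 \<le> t \<Longrightarrow> \<eta> \<in> \<Omega> \<Longrightarrow> K' t \<eta> = K (s + t) (glue s \<omega> \<eta>)"
    "\<And>\<eta>. \<eta> \<in> \<Omega> \<Longrightarrow> K' 0 \<eta> = K s \<omega>"
    using restarted_capital_process[of K lo hi \<omega> s] K w s unfolding hedges_def by blast
  have "-\<infinity> < (INF (t, \<eta>) \<in> {0..} \<times> \<Omega>. ereal (K t \<eta>))"
    using K by (simp add: hedges_def)
  also have "\<dots> \<le> (INF (t, \<eta>) \<in> {0..} \<times> \<Omega>. ereal (K' t \<eta>))"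
  proof (rule INF_mono)
    fix x :: "real \<times> cpath" assume "x \<in> {0..} \<times> \<Omega>"
    then show "\<exists>y\<in>{0..} \<times> \<Omega>. (case y of (t, \<eta>) \<Rightarrow> ereal (K t \<eta>))
        \<le> (case x of (t, \<eta>) \<Rightarrow> ereal (K' t \<eta>))"
      using K'(2)[of "fst x" "snd x"] s glue_in_counting_paths[OF w _ s, of "snd x"]
      by (intro bexI[of _ "(s + fst x, glue s \<omega> (snd x))"]) (auto split: prod.splits)
  qed
  finally have "-\<infinity> < (INF (t, \<eta>) \<in> {0..} \<times> \<Omega>. ereal (K' t \<eta>))" .
  moreover have "g (glue s \<omega> \<eta>) \<le> Liminf at_top (\<lambda>t. ereal (K' t \<eta>))" if e: "\<eta> \<in> \<Omega>" for \<eta>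
  proof -
    have "g (glue s \<omega> \<eta>) \<le> Liminf at_top (\<lambda>t. ereal (K t (glue s \<omega> \<eta>)))"
      using K e by (simp add: hedges_def)
    also have "\<dots> = Liminf at_top (\<lambda>t. ereal (K (s + t) (glue s \<omega> \<eta>)))"
      by (rule Liminf_at_top_shift[symmetric])
    also have "\<dots> = Liminf at_top (\<lambda>t. ereal (K' t \<eta>))"
      using K'(2) e by (intro Liminf_eq eventually_mono[OF eventually_ge_at_top[of 0]]) auto
    finally show ?thesis .
  qed
  ultimately have "K' \<in> hedges lo hi \<Omega> (\<lambda>\<eta>. g (glue s \<omega> \<eta>))"
    unfolding hedges_def using K'(1) by blast
  then show ?thesis using K'(3)[OF w] by (rule that)
qed

lemma delayed_hedge:
  assumes K: "K \<in> hedges lo hi \<Omega> (\<lambda>\<eta>. g (glue s \<omega> \<eta>))" and w: "\<omega> \<in> \<Omega>" and s: "0 \<le> s"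
  obtains K' where "K' \<in> hedges lo hi (glue s \<omega> ` \<Omega>) g" "K' s \<omega> = K 0 \<omega>"
proof -
  obtain K' where K': "K' \<in> capital_processes lo hi"
    "\<And>t \<eta>. 0 \<le> t \<Longrightarrow> \<eta> \<in> \<Omega> \<Longrightarrow> K' (s + t) (glue s \<omega> \<eta>) = K t \<eta>"
    "\<And>t \<eta>. \<eta> \<in> \<Omega> \<Longrightarrow> t \<le> s \<or> \<not> agree_upto (ereal s) \<omega> \<eta> \<Longrightarrow> K' t \<eta> = K 0 \<eta>"
    using delayed_capital_process[of K lo hi \<omega> s] K w s unfolding hedges_def by blast
  have "-\<infinity> < (INF (t, \<eta>) \<in> {0..} \<times> \<Omega>. ereal (K t \<eta>))"
    using K by (simp add: hedges_def)
  also have "\<dots> \<le> (INF (t, \<eta>) \<in> {0..} \<times> \<Omega>. ereal (K' t \<eta>))"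
  proof (rule INF_mono, safe)
    fix t :: real and \<eta> assume "0 \<le> t" and e: "\<eta> \<in> \<Omega>"
    show "\<exists>y\<in>{0..} \<times> \<Omega>. (case y of (t, \<eta>) \<Rightarrow> ereal (K t \<eta>)) \<le> ereal (K' t \<eta>)"
    proof (cases "t \<le> s \<or> \<not> agree_upto (ereal s) \<omega> \<eta>")
      case True
      then show ?thesis using K'(3)[OF e] e by (intro bexI[of _ "(0, \<eta>)"]) auto
    next
      case False
      then have "K' t \<eta> = K (t - s) (future s \<eta>)"
        using K'(2)[of "t - s" "future s \<eta>"] glue_future[OF w e s] future_in_counting_paths[OF e s]
        by auto
      then show ?thesis
        using False future_in_counting_paths[OF e s]
        by (intro bexI[of _ "(t - s, future s \<eta>)"]) auto
    qed
  qed
  finally have "-\<infinity> < (INF (t, \<eta>) \<in> {0..} \<times> \<Omega>. ereal (K' t \<eta>))" .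
  moreover have "g (glue s \<omega> \<eta>) \<le> Liminf at_top (\<lambda>t. ereal (K' t (glue s \<omega> \<eta>)))"
    if e: "\<eta> \<in> \<Omega>" for \<eta>
  proof -
    have "g (glue s \<omega> \<eta>) \<le> Liminf at_top (\<lambda>t. ereal (K t \<eta>))"
      using K e by (simp add: hedges_def)
    also have "\<dots> = Liminf at_top (\<lambda>t. ereal (K' (s + t) (glue s \<omega> \<eta>)))"
      using K'(2) e by (intro Liminf_eq eventually_mono[OF eventually_ge_at_top[of 0]]) auto
    also have "\<dots> = Liminf at_top (\<lambda>t. ereal (K' t (glue s \<omega> \<eta>)))"
      by (rule Liminf_at_top_shift)
    finally show ?thesis .
  qed
  ultimately have "K' \<in> hedges lo hi (glue s \<omega> ` \<Omega>) g"
    unfolding hedges_def using K'(1) by blast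
  moreover have "K' s \<omega> = K 0 \<omega>" using K'(3)[OF w] by blast
  ultimately show ?thesis by (rule that)
qed

theorem proposition7:
  fixes lo hi :: real
    and \<tau> :: "cpath \<Rightarrow> ereal"
    and f :: "cpath \<rightharpoonup> ereal"
    and \<omega> :: cpath
  assumes "0 \<le> lo" and "0 \<le> hi" and "lo \<le> hi"
    and "is_stopping_time \<tau>"
    and "f \<in> partial_vars \<tau>"
    and "\<omega> \<in> finite_event \<tau>"
  shows "upper_expectation_given lo hi f \<tau> \<omega> =
    upper_expectation lo hi ((\<lambda>\<eta>. f (stitch \<tau> \<omega> \<eta>)) |` \<Omega>)"
proof -
  have w: "\<omega> \<in> \<Omega>" and "\<tau> \<omega> < \<infinity>" "0 \<le> \<tau> \<omega>"
    using assms(4,6) stopping_time_nonneg by (auto simp: finite_event_def)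
  then obtain s where ts: "\<tau> \<omega> = ereal s" and s: "0 \<le> s"
    by (cases "\<tau> \<omega>") auto
  have glue: "stitch \<tau> \<omega> = glue s \<omega>" by (intro ext) (simp add: stitch_def ts)
  have past: "same_past \<tau> \<omega> = glue s \<omega> ` \<Omega>"
  proof (intro equalityI subsetI)
    fix \<eta> assume "\<eta> \<in> same_past \<tau> \<omega>"
    then have "\<eta> \<in> \<Omega>" "agree_upto (ereal s) \<omega> \<eta>" by (auto simp: same_past_def ts)
    then show "\<eta> \<in> glue s \<omega> ` \<Omega>"
      using glue_future[OF w _ s] future_in_counting_paths[OF _ s] by (metis imageI)
  next
    fix \<eta> assume "\<eta> \<in> glue s \<omega> ` \<Omega>"
    then show "\<eta> \<in> same_past \<tau> \<omega>"
      using w s agree_upto_glue glue_in_counting_paths by (auto simp: same_past_def ts)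
  qed
  have past0: "same_past (\<lambda>_. 0) \<omega> = \<Omega>"
    using w by (auto simp: same_past_def agree_upto_def counting_path_0)
  let ?H = "hedges lo hi (glue s \<omega> ` \<Omega>) (\<lambda>\<eta>. the (f \<eta>))"
  let ?G = "hedges lo hi \<Omega> (\<lambda>\<eta>. the (f (glue s \<omega> \<eta>)))"
  have "(INF K \<in> ?H. ereal (K s \<omega>)) = (INF K \<in> ?G. ereal (K 0 \<omega>))"
  proof (rule INF_eq)
    show "\<exists>K'\<in>?G. ereal (K' 0 \<omega>) \<le> ereal (K s \<omega>)" if "K \<in> ?H" for K
      using restarted_hedge[OF that w s] by (metis order_refl)
    show "\<exists>K'\<in>?H. ereal (K' s \<omega>) \<le> ereal (K 0 \<omega>)" if "K \<in> ?G" for K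
      using delayed_hedge[where g = "\<lambda>\<eta>. the (f \<eta>)", OF that w s] by (metis order_refl)
  qed
  moreover have "?G = hedges lo hi \<Omega> (\<lambda>\<eta>. the (((\<lambda>\<eta>. f (stitch \<tau> \<omega> \<eta>)) |` \<Omega>) \<eta>))"
    by (rule hedges_cong) (simp add: glue)
  ultimately show ?thesis
    unfolding upper_expectation_eq[OF w] upper_expectation_given_eq_INF_hedges past past0 ts by simp
qed

end
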